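(* Let $\lambda$ be a partition, $\pi$ a reverse plane partition of shape $\lambda$, and $\pi=h_1*h_2*\cdots*h_s*0$ (with $s\ge1$) a lexicographic factorisation of $\pi$. Then $h_2*\cdots*h_s*0=\pi-Q(v,\pi)$, where $v$ is the minimum of $\mathrm{cand}(\pi)$ with respect to the content order.
   Context: Cells are pairs $(i,j)\in\mathbb Z^2$; $\mathrm n(i,j)=(i-1,j)$, $\mathrm e(i,j)=(i,j+1)$, $\mathrm s(i,j)=(i+1,j)$, $\mathrm w(i,j)=(i,j-1)$. A partition $\lambda$ is identified with its Young diagram; $\lambda'$ is its conjugate. A reverse plane partition of shape $\lambda$ is $\pi:\lambda\to\mathbb N$ with $\pi(u)\le\pi(\mathrm e u),\pi(\mathrm s u)$, with conventions $\pi(i,j)=0$ if $i\le0$ or $j\le0$, $\pi(i,j)=\infty$ if $i,j\ge1$, $(i,j)\notin\lambda$; $0$ denotes the zero reverse plane partition. Content $c(i,j)=j-i$; outer corner: $u\in\lambda$, $\mathrm e u,\mathrm s u\notin\lambda$; inner corner: $\mathrm e u,\mathrm s u\in\lambda$, $\mathrm e\mathrm s u\notin\lambda$. With inner corner contents $i_1<\dots<i_r$ and outer corner contents $o_1<\dots<o_{r+1}$ (interlacing), $\mathcal I=\{u\in\lambda:c(u)=i_k\}$, $\mathcal O=\{u\in\lambda:c(u)=o_k\}$, $\mathcal A=\{u\in\lambda:c(u)<o_1\text{ or }i_k<c(u)<o_{k+1}\text{ for some }k\in[r]\}$, $\mathcal B=\{u\in\lambda:o_k<c(u)<i_k\text{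 for some }k\in[r]\text{ or }c(u)>o_{r+1}\}$. Content order: $(i,j)\trianglelefteq(k,l)$ iff $j-i>l-k$, or $j-i=l-k$ and $i\ge k$. Candidates: $\mathrm{cand}(\pi)=\{u\in\mathcal O:\pi(u)>\pi(\mathrm w u)\}\cup\{u\in\mathcal A:\pi(u)>\pi(\mathrm w u),\pi(u)>\pi(\mathrm n u)\}$. North-east path: $(u_0,\dots,u_s)$ in $\lambda$, $u_k\in\{\mathrm n u_{k-1},\mathrm e u_{k-1}\}$, length $s$, head $\alpha=u_0$, tail $\omega=u_s$. South-west path: $(v_0,\dots,v_s)$, $v_k\in\{\mathrm s v_{k-1},\mathrm w v_{k-1}\}$, length $s$, $\alpha=v_s$, $\omega=v_0$. Rim-hook: north-east path $h$ with $\mathrm s\alpha(h)\notin\lambda$, $\mathrm e\omega(h)\notin\lambda$, $\mathrm e\mathrm s u\notin\lambda$ for all $u\in h$; for $u=(i,j)\in\lambda$, $h^u$ is the rim-hook from $(\lambda'_j,j)$ to $(i,\lambda_i)$, and these are all rim-hooks. Reverse lexicographic order on cells: $(i,j)\le(k,l)$ iff $j>l$, or $j=l$ and $i\ge k$; rim-hooks ordered by $h^u\le h^v$ iff $u\le v$. $(\pi\pm P)(u)=\pi(u)\pm1$ for $u\in P$, else $\pi(u)$. $(P,\pi)$ compatible: $u\in P\cap(\mathcal I\cup\mathcal A)$ implies $\mathrm e u\in P$ and $\pi(u)=\pi(\mathrm e u)$; $u,\mathrm s u\in P$ implies $\pi(u)=\pi(\mathrm s u)$. $h$ inserts into $\pi$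 if some path $P$ has $\omega(P)=\omega(h)$, $\ell(P)=\ell(h)$, $(P,\pi)$ compatible and $\pi+P$ a reverse plane partition; then $h*\pi=\pi+P(h,\pi)$, with $P(h,\pi)$ the south-west path starting at $\omega(h)$ which, while its length is less than $\ell(h)$, moves from current cell $u$ to $\mathrm s u$ if $u\in\mathcal B\cup\mathcal I$ and $\pi(u)=\pi(\mathrm s u)$, and to $\mathrm w u$ otherwise. Iterated insertion is read right to left. A lexicographic factorisation of $\pi$ is an expression $\pi=h_1*h_2*\cdots*h_s*0$ with rim-hooks $h_1\le h_2\le\dots\le h_s$ (each insertion being defined). For $v\in\mathrm{cand}(\pi)$, $Q(v,\pi)$ is the north-east path starting at $v$ which, from current cell $u$, moves to $\mathrm n u$ if $u\in\mathcal O\cup\mathcal B$ and $\pi(u)=\pi(\mathrm n u)$; to $\mathrm e u$ if $u\in\mathcal I\cup\mathcal A$, or if $\mathrm e u\in\lambda$ and $\pi(u)>\pi(\mathrm n u)$; and terminates if $\pi(u)>\pi(\mathrm n u)$ and $\mathrm e u\notin\lambda$. *)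

theory Defs
  imports Main "HOL-Library.Extended_Nat"
begin

section \<open>Cells and partitions\<close>

text \<open>Cells use matrix coordinates (row, column), indexed from 1 inside a Young diagram.\<close>

type_synonym cell = "int \<times> int"

fun north :: "cell \<Rightarrow> cell" where "north (i, j) = (i - 1, j)"
fun east :: "cell \<Rightarrow> cell" where "east (i, j) = (i, j + 1)"
fun south :: "cell \<Rightarrow> cell" where "south (i, j) = (i + 1, j)"
fun west :: "cell \<Rightarrow> cell" where "west (i, j) = (i, j - 1)"

fun content :: "cell \<Rightarrow> int" where "content (i, j) = j - i"

definition is_partition :: "nat list \<Rightarrow> bool" where
  "is_partition lam \<longleftrightarrow> sorted_wrt (\<ge>) lam \<and> (\<forall>x\<in>set lam. 0 < x)"

definition part :: "nat list \<Rightarrow> int \<Rightarrow> int" where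
  "part lam i = (if 1 \<le> i \<and> i \<le> int (length lam) then int (lam ! nat (i - 1)) else 0)"

definition diagram :: "nat list \<Rightarrow> cell set" where
  "diagram lam = {(i, j). 1 \<le> i \<and> 1 \<le> j \<and> j \<le> part lam i}"

definition conj_part :: "nat list \<Rightarrow> int \<Rightarrow> int" where
  "conj_part lam j = int (card {i. (i, j) \<in> diagram lam})"

section \<open>Reverse plane partitions\<close>

text \<open>
  A reverse plane partition is stored as a total function on cells that already carries the
  conventional values \<open>0\<close> and \<open>\<infinity>\<close> outside the diagram, so that equality of reverse plane
  partitions of a fixed shape is equality of functions.
\<close>

definition rpp :: "nat list \<Rightarrow> (cell \<Rightarrow> enat) \<Rightarrow> bool" where
  "rpp lam \<pi> \<longleftrightarrow>
     (\<forall>i j. i \<le> 0 \<or> j \<le> 0 \<longrightarrow> \<pi> (i, j) = 0) \<and>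
     (\<forall>i j. 1 \<le> i \<and> 1 \<le> j \<and> (i, j) \<notin> diagram lam \<longrightarrow> \<pi> (i, j) = \<infinity>) \<and>
     (\<forall>u\<in>diagram lam. \<pi> u \<noteq> \<infinity> \<and> \<pi> u \<le> \<pi> (east u) \<and> \<pi> u \<le> \<pi> (south u))"

definition zero_rpp :: "nat list \<Rightarrow> cell \<Rightarrow> enat" where
  "zero_rpp lam = (\<lambda>(i, j). if 1 \<le> i \<and> 1 \<le> j \<and> (i, j) \<notin> diagram lam then \<infinity> else 0)"

definition add_cells :: "(cell \<Rightarrow> enat) \<Rightarrow> cell set \<Rightarrow> cell \<Rightarrow> enat" where
  "add_cells \<pi> P u = (if u \<in> P then \<pi> u + 1 else \<pi> u)"

text \<open>Subtraction on \<^typ>\<open>enat\<close> truncates at \<open>0\<close>; this is the intended difference only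
  if \<open>\<pi>\<close> is positive on \<open>P\<close>.\<close>

definition sub_cells :: "(cell \<Rightarrow> enat) \<Rightarrow> cell set \<Rightarrow> cell \<Rightarrow> enat" where
  "sub_cells \<pi> P u = (if u \<in> P then \<pi> u - 1 else \<pi> u)"

section \<open>Corners and the regions they determine\<close>

definition outer_corners :: "nat list \<Rightarrow> cell set" where
  "outer_corners lam = {u \<in> diagram lam. east u \<notin> diagram lam \<and> south u \<notin> diagram lam}"

definition inner_corners :: "nat list \<Rightarrow> cell set" where
  "inner_corners lam =
     {u \<in> diagram lam. east u \<in> diagram lam \<and> south u \<in> diagram lam \<and>
                       east (south u) \<notin> diagram lam}"

text \<open>
  The increasing lists of corner contents. Lists are indexed from 0, so \<open>i\<^sub>k\<close> is
  \<open>inner_contents lam ! (k - 1)\<close>, and likewise for \<open>o\<^sub>k\<close>. A nonempty diagram with \<open>r\<close> inner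
  corners has \<open>r + 1\<close> outer corners, so all accesses below are in range whenever there is
  a cell \<open>u\<close> in the diagram.
\<close>

definition inner_contents :: "nat list \<Rightarrow> int list" where
  "inner_contents lam = sorted_list_of_set (content ` inner_corners lam)"

definition outer_contents :: "nat list \<Rightarrow> int list" where
  "outer_contents lam = sorted_list_of_set (content ` outer_corners lam)"

definition region_I :: "nat list \<Rightarrow> cell set" where
  "region_I lam = {u \<in> diagram lam. content u \<in> set (inner_contents lam)}"

definition region_O :: "nat list \<Rightarrow> cell set" where
  "region_O lam = {u \<in> diagram lam. content u \<in> set (outer_contents lam)}"

definition region_A :: "nat list \<Rightarrow> cell set" where
  "region_A lam =
     {u \<in> diagram lam. content u < outer_contents lam ! 0 \<or>
        (\<exists>k<length (inner_contents lam).
           inner_contents lam ! k < content u \<and> content u < outer_contents lam ! Suc k)}"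

definition region_B :: "nat list \<Rightarrow> cell set" where
  "region_B lam =
     {u \<in> diagram lam.
        (\<exists>k<length (inner_contents lam).
           outer_contents lam ! k < content u \<and> content u < inner_contents lam ! k) \<or>
        outer_contents lam ! length (inner_contents lam) < content u}"

section \<open>Candidates\<close>

fun content_le :: "cell \<Rightarrow> cell \<Rightarrow> bool" where
  "content_le (i, j) (k, l) \<longleftrightarrow> j - i > l - k \<or> (j - i = l - k \<and> i \<ge> k)"

definition cand :: "nat list \<Rightarrow> (cell \<Rightarrow> enat) \<Rightarrow> cell set" where
  "cand lam \<pi> =
     {u \<in> region_O lam. \<pi> u > \<pi> (west u)} \<union>
     {u \<in> region_A lam. \<pi> u > \<pi> (west u) \<and> \<pi> u > \<pi> (north u)}"

definition is_min_cand :: "nat list \<Rightarrow> (cell \<Rightarrow> enat) \<Rightarrow> cell \<Rightarrow> bool" where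
  "is_min_cand lam \<pi> v \<longleftrightarrow> v \<in> cand lam \<pi> \<and> (\<forall>u\<in>cand lam \<pi>. content_le v u)"

section \<open>Paths and rim-hooks\<close>

text \<open>
  A path of length \<open>s\<close> is the list of its \<open>s + 1\<close> cells, so two paths have equal length iff the
  lists do. A north-east path has head \<^term>\<open>hd p\<close> and tail \<^term>\<open>last p\<close>; for a south-west
  path the roles are swapped: the head is \<^term>\<open>last p\<close> and the tail is \<^term>\<open>hd p\<close>.
\<close>

definition ne_path :: "nat list \<Rightarrow> cell list \<Rightarrow> bool" where
  "ne_path lam p \<longleftrightarrow> p \<noteq> [] \<and> set p \<subseteq> diagram lam \<and>
     (\<forall>k. Suc k < length p \<longrightarrow> p ! Suc k \<in> {north (p ! k), east (p ! k)})"

definition sw_path :: "nat list \<Rightarrow> cell list \<Rightarrow> bool" where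
  "sw_path lam p \<longleftrightarrow> p \<noteq> [] \<and> set p \<subseteq> diagram lam \<and>
     (\<forall>k. Suc k < length p \<longrightarrow> p ! Suc k \<in> {south (p ! k), west (p ! k)})"

definition rim_hook :: "nat list \<Rightarrow> cell list \<Rightarrow> bool" where
  "rim_hook lam h \<longleftrightarrow> ne_path lam h \<and>
     south (hd h) \<notin> diagram lam \<and> east (last h) \<notin> diagram lam \<and>
     (\<forall>u\<in>set h. east (south u) \<notin> diagram lam)"

text \<open>\<open>is_hook_at lam u h\<close> says that \<open>h\<close> is the rim-hook \<open>h\<^sup>u\<close>.\<close>

fun is_hook_at :: "nat list \<Rightarrow> cell \<Rightarrow> cell list \<Rightarrow> bool" where
  "is_hook_at lam (i, j) h \<longleftrightarrow>
     (i, j) \<in> diagram lam \<and> rim_hook lam h \<and>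
     hd h = (conj_part lam j, j) \<and> last h = (i, part lam i)"

fun revlex_le :: "cell \<Rightarrow> cell \<Rightarrow> bool" where
  "revlex_le (i, j) (k, l) \<longleftrightarrow> j > l \<or> (j = l \<and> i \<ge> k)"

definition hook_le :: "nat list \<Rightarrow> cell list \<Rightarrow> cell list \<Rightarrow> bool" where
  "hook_le lam g h \<longleftrightarrow>
     (\<exists>u v. is_hook_at lam u g \<and> is_hook_at lam v h \<and> revlex_le u v)"

section \<open>Insertion of rim-hooks\<close>

definition compatible :: "nat list \<Rightarrow> cell set \<Rightarrow> (cell \<Rightarrow> enat) \<Rightarrow> bool" where
  "compatible lam P \<pi> \<longleftrightarrow>
     (\<forall>u \<in> P \<inter> (region_I lam \<union> region_A lam). east u \<in> P \<and> \<pi> u = \<pi> (east u)) \<and>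
     (\<forall>u. u \<in> P \<and> south u \<in> P \<longrightarrow> \<pi> u = \<pi> (south u))"

text \<open>
  Reversing a north-east path gives a south-west path with the same cells, length, head and tail,
  so quantifying over south-west paths covers all paths.
\<close>

definition inserts :: "nat list \<Rightarrow> cell list \<Rightarrow> (cell \<Rightarrow> enat) \<Rightarrow> bool" where
  "inserts lam h \<pi> \<longleftrightarrow>
     (\<exists>P. sw_path lam P \<and> hd P = last h \<and> length P = length h \<and>
          compatible lam (set P) \<pi> \<and> rpp lam (add_cells \<pi> (set P)))"

definition P_step :: "nat list \<Rightarrow> (cell \<Rightarrow> enat) \<Rightarrow> cell \<Rightarrow> cell" where
  "P_step lam \<pi> u =
     (if u \<in> region_B lam \<union> region_I lam \<and> \<pi> u = \<pi> (south u) then south u else west u)"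

definition P_path :: "nat list \<Rightarrow> cell list \<Rightarrow> (cell \<Rightarrow> enat) \<Rightarrow> cell list" where
  "P_path lam h \<pi> = map (\<lambda>k. (P_step lam \<pi> ^^ k) (last h)) [0..<length h]"

definition insert_hook ::
    "nat list \<Rightarrow> cell list \<Rightarrow> (cell \<Rightarrow> enat) \<Rightarrow> (cell \<Rightarrow> enat) option" where
  "insert_hook lam h \<pi> =
     (if inserts lam h \<pi> then Some (add_cells \<pi> (set (P_path lam h \<pi>))) else None)"

text \<open>\<open>insert_hooks lam [h\<^sub>1, \<dots>, h\<^sub>s]\<close> is \<open>h\<^sub>1 * \<cdots> * h\<^sub>s * 0\<close>, or \<^const>\<open>None\<close> if one of
  the insertions is undefined.\<close>

fun insert_hooks :: "nat list \<Rightarrow> cell list list \<Rightarrow> (cell \<Rightarrow> enat) option" where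
  "insert_hooks lam [] = Some (zero_rpp lam)"
| "insert_hooks lam (h # hs) = Option.bind (insert_hooks lam hs) (insert_hook lam h)"

definition lex_factorisation :: "nat list \<Rightarrow> (cell \<Rightarrow> enat) \<Rightarrow> cell list list \<Rightarrow> bool" where
  "lex_factorisation lam \<pi> hs \<longleftrightarrow>
     (\<forall>h\<in>set hs. rim_hook lam h) \<and> sorted_wrt (hook_le lam) hs \<and>
     insert_hooks lam hs = Some \<pi>"

section \<open>The extraction path\<close>

text \<open>
  \<open>Q_path lam \<pi> v q\<close> says that \<open>q\<close> is the path \<open>Q(v, \<pi>)\<close>. The three rules below exclude each
  other, so there is at most one such \<open>q\<close>.
\<close>

definition Q_moves_north :: "nat list \<Rightarrow> (cell \<Rightarrow> enat) \<Rightarrow> cell \<Rightarrow> bool" where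
  "Q_moves_north lam \<pi> u \<longleftrightarrow> u \<in> region_O lam \<union> region_B lam \<and> \<pi> u = \<pi> (north u)"

definition Q_moves_east :: "nat list \<Rightarrow> (cell \<Rightarrow> enat) \<Rightarrow> cell \<Rightarrow> bool" where
  "Q_moves_east lam \<pi> u \<longleftrightarrow>
     u \<in> region_I lam \<union> region_A lam \<or> (east u \<in> diagram lam \<and> \<pi> u > \<pi> (north u))"

definition Q_stops :: "nat list \<Rightarrow> (cell \<Rightarrow> enat) \<Rightarrow> cell \<Rightarrow> bool" where
  "Q_stops lam \<pi> u \<longleftrightarrow> \<pi> u > \<pi> (north u) \<and> east u \<notin> diagram lam"

definition Q_path :: "nat list \<Rightarrow> (cell \<Rightarrow> enat) \<Rightarrow> cell \<Rightarrow> cell list \<Rightarrow> bool" where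
  "Q_path lam \<pi> v q \<longleftrightarrow> ne_path lam q \<and> hd q = v \<and>
     (\<forall>k. Suc k < length q \<longrightarrow>
        (Q_moves_north lam \<pi> (q ! k) \<and> q ! Suc k = north (q ! k)) \<or>
        (Q_moves_east lam \<pi> (q ! k) \<and> q ! Suc k = east (q ! k))) \<and>
     Q_stops lam \<pi> (last q)"

end

theory Submission
  imports Defs
begin

text \<open>
  Let \<open>\<pi> = h * \<pi>'\<close>. A path that witnesses the insertion of \<open>h\<close> is unique, and reading it backwards
  obeys the rules of \<open>Q\<close> in \<open>\<pi>\<close>; so only the minimality of its head is at stake. Every candidate of
  \<open>\<pi>\<close> preceding that head would already force a candidate of \<open>\<pi>'\<close> preceding it. By induction the
  minimal candidate of \<open>\<pi>'\<close> is the head of the previous insertion path, and this comes weakly after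
  the new head: for different columns by the order of the rim-hooks, and for equal columns because
  the new path, starting weakly south-east of the old one, never crosses it.
\<close>

section \<open>Partitions and diagrams\<close>

lemma content_simps [simp]:
  "content (north u) = content u + 1" "content (east u) = content u + 1"
  "content (south u) = content u - 1" "content (west u) = content u - 1"
  by (cases u; simp)+

lemma cell_eqI: "content u = content v \<Longrightarrow> fst u = fst v \<Longrightarrow> u = v"
  by (cases u; cases v; simp)

lemma part_antimono:
  assumes "is_partition lam" "1 \<le> i" "i \<le> k"
  shows "part lam k \<le> part lam i"
proof (cases "i = k \<or> int (length lam) < k")
  case True
  then show ?thesis by (auto simp: part_def)
next
  case False
  have "sorted_wrt (\<ge>) lam"
    using assms(1) by (simp add: is_partition_def)
  then have "lam ! nat (i - 1) \<ge> lam ! nat (k - 1)"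
    by (rule sorted_wrt_nth_less) (use False assms in auto)
  then show ?thesis using False assms by (auto simp: part_def)
qed

lemma part_pos:
  assumes "is_partition lam" "1 \<le> i" "i \<le> int (length lam)"
  shows "1 \<le> part lam i"
proof -
  have "lam ! nat (i - 1) \<in> set lam" using assms by (intro nth_mem) auto
  then have "0 < lam ! nat (i - 1)" using assms(1) by (simp add: is_partition_def)
  then show ?thesis using assms by (simp add: part_def)
qed

lemma part_pos_imp: "1 \<le> part lam i \<Longrightarrow> 1 \<le> i \<and> i \<le> int (length lam)"
  by (auto simp: part_def split: if_splits)

lemma diagram_iff: "(i, j) \<in> diagram lam \<longleftrightarrow> 1 \<le> i \<and> 1 \<le> j \<and> j \<le> part lam i"
  by (simp add: diagram_def)

lemma diagram_down:
  assumes "is_partition lam" "(i, j) \<in> diagram lam" "1 \<le> k" "k \<le> i" "1 \<le> l" "l \<le> j"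
  shows "(k, l) \<in> diagram lam"
  using assms part_antimono[of lam k i] by (auto simp: diagram_iff)

section \<open>Regions\<close>

text \<open>
  The cell in which the rim meets the diagonal \<open>c\<close> is left northwards iff a row of the diagram ends
  on that diagonal. The last rim cell,
  at the end of the first row, counts as being left northwards.
\<close>

definition north_step :: "nat list \<Rightarrow> int \<Rightarrow> bool" where
  "north_step lam c \<longleftrightarrow> (\<exists>i. 1 \<le> i \<and> i \<le> int (length lam) \<and> c = part lam i - i)"

lemma north_step_bounds:
  assumes "is_partition lam" "north_step lam c"
  shows "1 - int (length lam) \<le> c \<and> c \<le> part lam 1 - 1"
proof -
  obtain i where i: "1 \<le> i" "i \<le> int (length lam)" "c = part lam i - i"
    using assms(2) by (auto simp: north_step_def)
  then show ?thesis
    using part_antimono[OF assms(1), of 1 i] part_pos[OF assms(1), of i] by auto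
qed

lemma content_bounds:
  assumes "is_partition lam" "u \<in> diagram lam"
  shows "1 - int (length lam) \<le> content u \<and> content u \<le> part lam 1 - 1"
proof -
  obtain i j where u: "u = (i, j)" by (cases u)
  then have "1 \<le> i" "1 \<le> j" "j \<le> part lam i" using assms(2) by (auto simp: diagram_iff)
  then show ?thesis
    using u part_antimono[OF assms(1), of 1 i] part_pos_imp[of lam i] by auto
qed

text \<open>The diagonals \<open>part lam i - i\<close> strictly decrease with i. So if row i ends
  on c, only row i + 1 can end on c - 1, and it does so exactly when it is as long as row i.\<close>

lemma outer_corner_contents:
  assumes lam: "is_partition lam"
  shows "content ` outer_corners lam = {c. north_step lam c \<and> \<not> north_step lam (c - 1)}"
    (is "?L = ?R")
proof (intro equalityI subsetI)
  fix c assume "c \<in> ?L"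
  then obtain i j where ij: "(i, j) \<in> outer_corners lam" "c = j - i" by auto
  then have 1: "1 \<le> i" "1 \<le> j" "j = part lam i" "\<not> j \<le> part lam (i + 1)"
    by (auto simp: outer_corners_def diagram_iff)
  have "\<not> north_step lam (c - 1)"
  proof
    assume "north_step lam (c - 1)"
    then obtain k where k: "1 \<le> k" "c - 1 = part lam k - k" by (auto simp: north_step_def)
    show False
      using k 1 ij part_antimono[OF lam, of k i] part_antimono[OF lam, of "i + 1" k]
      by (cases "k \<le> i") auto
  qed
  moreover have "north_step lam c"
    using 1 ij part_pos_imp[of lam i] by (auto simp: north_step_def)
  ultimately show "c \<in> ?R" by simp
next
  fix c assume "c \<in> ?R"
  then obtain i where i: "1 \<le> i" "i \<le> int (length lam)" "c = part lam i - i"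
    and n: "\<not> north_step lam (c - 1)" by (auto simp: north_step_def)
  have "part lam (i + 1) < part lam i"
  proof (rule ccontr)
    assume "\<not> ?thesis"
    then have "part lam (i + 1) = part lam i" using part_antimono[OF lam, of i "i + 1"] i by auto
    then have "north_step lam (c - 1)"
      using i part_pos[OF lam, of i] part_pos_imp[of lam "i + 1"]
      unfolding north_step_def by (intro exI[of _ "i + 1"]) auto
    with n show False by simp
  qed
  then have "(i, part lam i) \<in> outer_corners lam"
    using i part_pos[OF lam, of i] by (auto simp: outer_corners_def diagram_iff)
  then show "c \<in> ?L" using i by force
qed

text \<open>As for outer corners, now against the row above. The bound \<open>part lam 1\<close>
  removes the diagonal just past the rim, which would qualify because the last rim cell counts as
  left northwards.\<close>

lemma inner_corner_contents:
  assumes lam: "is_partition lam"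
  shows "content ` inner_corners lam =
    {c. \<not> north_step lam c \<and> north_step lam (c - 1) \<and> c < part lam 1}" (is "?L = ?R")
proof (intro equalityI subsetI)
  fix c assume "c \<in> ?L"
  then obtain i j where ij: "(i, j) \<in> inner_corners lam" "c = j - i" by auto
  then have 1: "1 \<le> i" "1 \<le> j" "j + 1 \<le> part lam i" "j = part lam (i + 1)"
    by (auto simp: inner_corners_def diagram_iff)
  have "\<not> north_step lam c"
  proof
    assume "north_step lam c"
    then obtain k where k: "1 \<le> k" "c = part lam k - k" by (auto simp: north_step_def)
    show False
      using k 1 ij part_antimono[OF lam, of k i] part_antimono[OF lam, of "i + 1" k]
      by (cases "k \<le> i") auto
  qed
  moreover have "north_step lam (c - 1)"
    using 1 ij part_pos_imp[of lam "i + 1"]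
    unfolding north_step_def by (intro exI[of _ "i + 1"]) auto
  moreover have "c < part lam 1"
    using 1 ij part_antimono[OF lam, of 1 i] by auto
  ultimately show "c \<in> ?R" by simp
next
  fix c assume "c \<in> ?R"
  then obtain i where i: "1 \<le> i" "i \<le> int (length lam)" "c - 1 = part lam i - i"
    and n: "\<not> north_step lam c" "c < part lam 1" by (auto simp: north_step_def)
  have i1: "i \<noteq> 1" using i n by auto
  have "part lam i < part lam (i - 1)"
  proof (rule ccontr)
    assume "\<not> ?thesis"
    then have "part lam (i - 1) = part lam i"
      using part_antimono[OF lam, of "i - 1" i] i i1 by auto
    then have "north_step lam c"
      using i i1 unfolding north_step_def by (intro exI[of _ "i - 1"]) auto
    with n show False by simp
  qed
  then have "(i - 1, part lam i) \<in> inner_corners lam"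
    using i i1 part_pos[OF lam, of i] by (auto simp: inner_corners_def diagram_iff)
  then show "c \<in> ?L" using i by force
qed

section \<open>Counting corners along the rim\<close>

abbreviation count_below :: "int set \<Rightarrow> int \<Rightarrow> nat" where
  "count_below X c \<equiv> card {x \<in> X. x < c}"

text \<open>The entries below c form an initial segment of the list. This turns the indexed
  comparisons in \<open>region_A\<close> and \<open>region_B\<close> into cardinalities.\<close>

lemma nth_sorted_list_of_set_less_iff:
  assumes "finite X" "k < card X"
  shows "sorted_list_of_set X ! k < c \<longleftrightarrow> k < count_below X c"
proof -
  let ?xs = "sorted_list_of_set X"
  have len: "length ?xs = card X" and set: "set ?xs = X" and dist: "distinct ?xs"
    using assms(1) by auto
  have mono: "?xs ! m \<le> ?xs ! n" if "m \<le> n" "n < card X" for m n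
    using that len by (intro sorted_nth_mono) auto
  have "{x \<in> X. x < c} = (\<lambda>m. ?xs ! m) ` {m. m < card X \<and> ?xs ! m < c}"
    using set len by (auto simp: set_conv_nth)
  moreover have "inj_on (\<lambda>m. ?xs ! m) {m. m < card X \<and> ?xs ! m < c}"
    using dist len by (auto intro!: inj_on_nth)
  ultimately have card: "count_below X c = card {m. m < card X \<and> ?xs ! m < c}"
    by (simp add: card_image)
  show ?thesis
  proof
    assume "?xs ! k < c"
    then have "{..k} \<subseteq> {m. m < card X \<and> ?xs ! m < c}"
      using mono[of _ k] assms(2) by fastforce
    from card_mono[OF _ this] show "k < count_below X c" using card by simp
  next
    assume *: "k < count_below X c"
    show "?xs ! k < c"
    proof (rule ccontr)
      assume "\<not> ?xs ! k < c"
      then have "\<not> ?xs ! m < c" if "k \<le> m" "m < card X" for m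
        using mono[OF that] by linarith
      then have "{m. m < card X \<and> ?xs ! m < c} \<subseteq> {..<k}"
        by (auto simp: not_le[symmetric])
      from card_mono[OF _ this] show False using card * by simp
    qed
  qed
qed

lemma count_below_Suc:
  assumes "finite X"
  shows "count_below X (c + 1) = count_below X c + (if c \<in> X then 1 else 0)"
proof (cases "c \<in> X")
  case True
  then have "{x \<in> X. x < c + 1} = insert c {x \<in> X. x < c}" by auto
  then show ?thesis using assms True by simp
next
  case False
  have "x < c + 1 \<longleftrightarrow> x < c" if "x \<in> X" for x using False that by (cases "x = c") auto
  then have "{x \<in> X. x < c + 1} = {x \<in> X. x < c}" by blast
  then show ?thesis using False by simp
qed

context
  fixes lam :: "nat list"
  assumes lam: "is_partition lam"
begin

text \<open>Interlacing as a count. A corner occurs exactly where \<open>north_step\<close> changes,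
  an outer one when it becomes true and an inner one when it becomes false, so induction along the
  diagonals keeps the surplus at 0 or 1.\<close>

lemma corner_count:
  assumes "1 - int (length lam) \<le> c + 1" "c < part lam 1"
  shows "count_below (content ` outer_corners lam) (c + 1) =
    count_below (content ` inner_corners lam) (c + 1) + (if north_step lam c then 1 else 0)"
    (is "count_below ?O _ = count_below ?I _ + _")
proof -
  have fin: "finite ?O" "finite ?I"
    unfolding outer_corner_contents[OF lam] inner_corner_contents[OF lam]
    by (rule finite_subset[of _ "{- int (length lam) .. part lam 1}"],
        use north_step_bounds[OF lam] in \<open>force+\<close>)+
  have "- int (length lam) \<le> c" using assms(1) by simp
  then show ?thesis using assms(2)
  proof (induction c rule: int_ge_induct)
    case base
    have *: "\<not> north_step lam x" if "x < 1 - int (length lam)" for x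
      using north_step_bounds[OF lam, of x] that by linarith
    have "{x \<in> ?O. x < 1 - int (length lam)} = {}" "{x \<in> ?I. x < 1 - int (length lam)} = {}"
      unfolding outer_corner_contents[OF lam] inner_corner_contents[OF lam]
      using * by auto
    then have "count_below ?O (1 - int (length lam)) = 0" "count_below ?I (1 - int (length lam)) = 0"
      by (simp_all only: card.empty)
    then show ?case using * by simp
  next
    case (step c)
    have "(c + 1 \<in> ?O) = (north_step lam (c + 1) \<and> \<not> north_step lam c)"
      unfolding outer_corner_contents[OF lam] by simp
    moreover have "(c + 1 \<in> ?I) = (\<not> north_step lam (c + 1) \<and> north_step lam c)"
      unfolding inner_corner_contents[OF lam] using step.prems by simp
    ultimately show ?case
      using step.IH step.prems
      unfolding count_below_Suc[OF fin(1), of "c + 1"] count_below_Suc[OF fin(2), of "c + 1"]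
      by auto
  qed
qed

text \<open>\<open>north_step\<close> at \<open>content u - 1\<close> and at
  \<open>content u\<close> tells how the rim enters and leaves the diagonal of u; the four
  combinations are the four regions. The list indices are eliminated by counting corners.\<close>

lemma region_iff:
  assumes u: "u \<in> diagram lam"
  shows region_I_iff: "u \<in> region_I lam \<longleftrightarrow> \<not> north_step lam (content u) \<and> north_step lam (content u - 1)"
    and region_O_iff: "u \<in> region_O lam \<longleftrightarrow> north_step lam (content u) \<and> \<not> north_step lam (content u - 1)"
    and region_A_iff: "u \<in> region_A lam \<longleftrightarrow> \<not> north_step lam (content u) \<and> \<not> north_step lam (content u - 1)"
    and region_B_iff: "u \<in> region_B lam \<longleftrightarrow> north_step lam (content u) \<and> north_step lam (content u - 1)"
proof -
  define X where "X = content ` outer_corners lam"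
  define Y where "Y = content ` inner_corners lam"
  define c where "c = content u"
  have X: "X = {c. north_step lam c \<and> \<not> north_step lam (c - 1)}"
    unfolding X_def by (rule outer_corner_contents[OF lam])
  have Y: "Y = {c. \<not> north_step lam c \<and> north_step lam (c - 1) \<and> c < part lam 1}"
    unfolding Y_def by (rule inner_corner_contents[OF lam])
  have bounds: "x < part lam 1 \<and> 1 - int (length lam) \<le> x" if "x \<in> X \<union> Y" for x
    using that north_step_bounds[OF lam, of x] north_step_bounds[OF lam, of "x - 1"]
    by (auto simp: X Y)
  then have "X \<union> Y \<subseteq> {1 - int (length lam) .. part lam 1}"
    by (meson atLeastAtMost_iff less_imp_le subsetI)
  then have fin: "finite X" "finite Y"
    using finite_subset[OF _ finite_atLeastAtMost_int] by auto
  have c: "1 - int (length lam) \<le> c" "c < part lam 1"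
    using content_bounds[OF lam u] by (auto simp: c_def)
  have lists: "outer_contents lam = sorted_list_of_set X" "inner_contents lam = sorted_list_of_set Y"
    by (simp_all add: outer_contents_def inner_contents_def X_def Y_def)
  \<comment> \<open>Counting up to the last diagonal covers all corners and gives one more outer
    than inner corner, so the list accesses stay in range.\<close>
  have "north_step lam (part lam 1 - 1)"
    using c unfolding north_step_def by (intro exI[of _ 1]) (auto simp: part_def split: if_splits)
  then have "count_below X (part lam 1) = count_below Y (part lam 1) + 1"
    using corner_count[of "part lam 1 - 1"] c by (simp add: X_def Y_def)
  moreover have "{x \<in> X. x < part lam 1} = X" "{x \<in> Y. x < part lam 1} = Y"
    using bounds by auto
  ultimately have cards: "card X = card Y + 1" by simp
  have below: "sorted_list_of_set X ! k < c \<longleftrightarrow> k < count_below X c"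
    and above: "c < sorted_list_of_set X ! k \<longleftrightarrow> count_below X (c + 1) \<le> k"
    if "k < card X" for k
    using nth_sorted_list_of_set_less_iff[OF fin(1) that, of c]
      nth_sorted_list_of_set_less_iff[OF fin(1) that, of "c + 1"] by auto
  have below': "sorted_list_of_set Y ! k < c \<longleftrightarrow> k < count_below Y c"
    and above': "c < sorted_list_of_set Y ! k \<longleftrightarrow> count_below Y (c + 1) \<le> k"
    if "k < card Y" for k
    using nth_sorted_list_of_set_less_iff[OF fin(2) that, of c]
      nth_sorted_list_of_set_less_iff[OF fin(2) that, of "c + 1"] by auto
  have le: "count_below X c \<le> card X" "count_below Y c \<le> card Y" "count_below Y (c + 1) \<le> card Y"
    by (auto intro!: card_mono fin)
  have count: "count_below X (c + 1) = count_below Y (c + 1) + (if north_step lam c then 1 else 0)"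
    unfolding X_def Y_def by (rule corner_count) (use c in auto)
  note suc = count_below_Suc[OF fin(1), of c] count_below_Suc[OF fin(2), of c]
  have memX: "c \<in> X \<longleftrightarrow> north_step lam c \<and> \<not> north_step lam (c - 1)"
    and memY: "c \<in> Y \<longleftrightarrow> \<not> north_step lam c \<and> north_step lam (c - 1)"
    using c by (auto simp: X Y)
  show "u \<in> region_I lam \<longleftrightarrow> \<not> north_step lam (content u) \<and> north_step lam (content u - 1)"
    using memY fin u by (auto simp: region_I_def lists c_def)
  show "u \<in> region_O lam \<longleftrightarrow> north_step lam (content u) \<and> \<not> north_step lam (content u - 1)"
    using memX fin u by (auto simp: region_O_def lists c_def)
  \<comment> \<open>Used with n outer corners up to c and m inner corners before c; in
    \<open>ex_B\<close>, n counts outer corners before c and m inner corners up to c.\<close>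
  have ex_A: "(n \<le> 0 \<or> (\<exists>k<r. k < m \<and> n \<le> Suc k)) \<longleftrightarrow> n \<le> m" if "m \<le> r" for m n r :: nat
  proof
    assume "n \<le> m"
    then show "n \<le> 0 \<or> (\<exists>k<r. k < m \<and> n \<le> Suc k)"
      using that by (cases n) (auto simp: Suc_le_eq intro: less_le_trans)
  qed auto
  have ex_B: "((\<exists>k<r. k < n \<and> m \<le> k) \<or> r < n) \<longleftrightarrow> m < n" if "m \<le> r" for m n r :: nat
    using that by (metis le_less_trans le_neq_implies_less order_refl)
  have "u \<in> region_A lam \<longleftrightarrow> count_below X (c + 1) \<le> 0 \<or>
      (\<exists>k<card Y. k < count_below Y c \<and> count_below X (c + 1) \<le> Suc k)"
    using u above[of 0] below' above cards
    unfolding region_A_def lists by (auto simp: c_def)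
  also have "\<dots> \<longleftrightarrow> count_below X (c + 1) \<le> count_below Y c"
    by (rule ex_A) (rule le)
  \<comment> \<open>The left count is the right one plus 1 if c is in Y plus 1 if
    \<open>north_step lam c\<close>; both terms must vanish.\<close>
  also have "\<dots> \<longleftrightarrow> \<not> north_step lam c \<and> \<not> north_step lam (c - 1)"
    using count suc memX memY by auto
  finally show "u \<in> region_A lam \<longleftrightarrow>
    \<not> north_step lam (content u) \<and> \<not> north_step lam (content u - 1)" by (simp add: c_def)
  have "u \<in> region_B lam \<longleftrightarrow> 
      (\<exists>k<card Y. k < count_below X c \<and> count_below Y (c + 1) \<le> k) \<or> card Y < count_below X c"
    using u below[of "card Y"] below above' cards
    unfolding region_B_def lists by (auto simp: c_def)
  also have "\<dots> \<longleftrightarrow> count_below Y (c + 1) < count_below X c"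
    by (rule ex_B) (rule le)
  also have "\<dots> \<longleftrightarrow> north_step lam c \<and> north_step lam (c - 1)"
    using count suc memX memY by (auto split: if_splits)
  finally show "u \<in> region_B lam \<longleftrightarrow>
    north_step lam (content u) \<and> north_step lam (content u - 1)" by (simp add: c_def)
qed

lemmas region_iffs = region_I_iff region_O_iff region_A_iff region_B_iff

text \<open>Rows up to i reach column j and end on diagonals at least j - i; later rows stop before
  column j and end on diagonals at most j - i - 2.\<close>

lemma no_north_step_below_column:
  assumes "(i, j) \<in> diagram lam" "(i + 1, j) \<notin> diagram lam"
  shows "\<not> north_step lam (j - i - 1)"
proof
  assume "north_step lam (j - i - 1)"
  then obtain k where k: "1 \<le> k" "j - i - 1 = part lam k - k" by (auto simp: north_step_def)
  show False
    using k assms part_antimono[OF lam, of k i] part_antimono[OF lam, of "i + 1" k]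
    by (cases "k \<le> i") (auto simp: diagram_iff)
qed

section \<open>Reverse plane partitions and candidates\<close>

lemma rpp_finite: "rpp lam \<pi> \<Longrightarrow> u \<in> diagram lam \<Longrightarrow> \<pi> u \<noteq> \<infinity>"
  by (simp add: rpp_def)

lemma rpp_north_le:
  assumes "rpp lam \<pi>" "u \<in> diagram lam"
  shows "\<pi> (north u) \<le> \<pi> u"
proof -
  obtain i j where u: "u = (i, j)" by (cases u)
  show ?thesis
  proof (cases "i \<le> 1")
    case True
    then show ?thesis using assms u by (simp add: rpp_def)
  next
    case False
    then have "(i - 1, j) \<in> diagram lam"
      using assms u diagram_down[OF lam, of i j "i - 1" j] by (auto simp: diagram_iff)
    then show ?thesis using assms u by (force simp: rpp_def)
  qed
qed

lemma rpp_west_le: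
  assumes "rpp lam \<pi>" "u \<in> diagram lam"
  shows "\<pi> (west u) \<le> \<pi> u"
proof -
  obtain i j where u: "u = (i, j)" by (cases u)
  show ?thesis
  proof (cases "j \<le> 1")
    case True
    then show ?thesis using assms u by (simp add: rpp_def)
  next
    case False
    then have "(i, j - 1) \<in> diagram lam"
      using assms u diagram_down[OF lam, of i j i "j - 1"] by (auto simp: diagram_iff)
    then show ?thesis using assms u by (force simp: rpp_def)
  qed
qed

lemma rpp_zero: "rpp lam (zero_rpp lam)"
proof -
  have "zero_rpp lam u = 0" if "u \<in> diagram lam" for u using that by (cases u) (simp add: zero_rpp_def)
  then show ?thesis by (auto simp: rpp_def zero_rpp_def)
qed

lemma cand_zero: "cand lam (zero_rpp lam) = {}"
  by (fastforce simp: cand_def zero_rpp_def region_O_def region_A_def)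

lemma cand_in_diagram: "u \<in> cand lam \<pi> \<Longrightarrow> u \<in> diagram lam"
  by (auto simp: cand_def region_O_def region_A_def)

text \<open>
  If such a cell is not itself a candidate, the value strictly above it is the same and larger than
  that of its own western neighbour, so one can climb until a candidate is reached.
\<close>

lemma ex_cand_content_ge:
  assumes \<pi>: "rpp lam \<pi>"
  shows "u \<in> diagram lam \<Longrightarrow> \<not> north_step lam (content u - 1) \<Longrightarrow> \<pi> (west u) < \<pi> u \<Longrightarrow>
    \<exists>v\<in>cand lam \<pi>. content u \<le> content v"
proof (induction "nat (fst u)" arbitrary: u rule: less_induct)
  case less
  show ?case
  proof (cases "u \<in> cand lam \<pi>")
    case True
    then show ?thesis by auto
  next
    case False
    \<comment> \<open>Only regions O and A remain, and in O the inequality to the west would make u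
      a candidate.\<close>
    then have A: "\<not> north_step lam (content u)" and eq: "\<pi> u \<le> \<pi> (north u)"
      using less.prems by (auto simp: cand_def region_iffs)
    obtain i j where u: "u = (i, j)" by (cases u)
    have ij: "1 \<le> i" "1 \<le> j" using less.prems u by (auto simp: diagram_iff)
    \<comment> \<open>Row 0 carries the conventional value 0, so a positive value above u keeps that
      cell in the diagram.\<close>
    have "0 < \<pi> (north u)" using less.prems(3) eq by (metis le_less_trans less_le_trans zero_le)
    then have "1 \<le> i - 1" using \<pi> u by (cases "i - 1 \<le> 0") (auto simp: rpp_def)
    then have n: "north u \<in> diagram lam"
      using less.prems u ij diagram_down[OF lam, of i j "i - 1" j] by auto
    have "\<pi> (west (north u)) \<le> \<pi> (west u)"
    proof (cases "j = 1")
      case True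
      then show ?thesis using \<pi> u by (simp add: rpp_def)
    next
      case False
      then have "west u \<in> diagram lam"
        using less.prems u ij diagram_down[OF lam, of i j i "j - 1"] by auto
      from rpp_north_le[OF \<pi> this] show ?thesis using u by simp
    qed
    then have "\<pi> (west (north u)) < \<pi> (north u)" using less.prems(3) eq by order
    moreover have "nat (fst (north u)) < nat (fst u)" using u ij by simp
    ultimately have "\<exists>v\<in>cand lam \<pi>. content (north u) \<le> content v"
      using less.hyps[of "north u"] n A by simp
    then obtain v where "v \<in> cand lam \<pi>" "content (north u) \<le> content v" by blast
    then show ?thesis by (intro bexI[of _ v]) auto
  qed
qed

section \<open>Insertion paths\<close>

lemma sw_path_content:
  assumes "sw_path lam' p" "k < length p"
  shows "content (p ! k) = content (hd p) - int k"
  using assms(2)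
proof (induction k)
  case 0
  then show ?case using assms by (simp add: sw_path_def hd_conv_nth)
next
  case (Suc k)
  then have "p ! Suc k \<in> {south (p ! k), west (p ! k)}" using assms(1) by (simp add: sw_path_def)
  then show ?case using Suc by auto
qed

lemma content_last_sw_path:
  assumes "sw_path lam' p"
  shows "content (last p) = content (hd p) - int (length p) + 1"
proof -
  have "p \<noteq> []" using assms by (simp add: sw_path_def)
  then show ?thesis
    using sw_path_content[OF assms, of "length p - 1"]
    by (simp add: last_conv_nth Suc_le_eq of_nat_diff)
qed

lemma ne_path_content:
  assumes "ne_path lam' p" "k < length p"
  shows "content (p ! k) = content (hd p) + int k"
  using assms(2)
proof (induction k)
  case 0
  then show ?case using assms by (simp add: ne_path_def hd_conv_nth)
next
  case (Suc k)
  then have "p ! Suc k \<in> {north (p ! k), east (p ! k)}" using assms(1) by (simp add: ne_path_def)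
  then show ?case using Suc by auto
qed

text \<open>Content drops by one at every step. Used to show that a cell is off the path because
  another path cell occupies its diagonal.\<close>

lemma sw_path_content_inj:
  assumes "sw_path lam' p" "u \<in> set p" "v \<in> set p" "content u = content v"
  shows "u = v"
  using assms sw_path_content[OF assms(1)] by (auto simp: in_set_conv_nth)

lemma sw_path_content_last:
  assumes "sw_path lam' p" "u \<in> set p"
  shows "content (last p) \<le> content u"
proof -
  have "p \<noteq> []" using assms(2) by auto
  obtain k where "k < length p" "u = p ! k" using assms(2) by (auto simp: in_set_conv_nth)
  then show ?thesis using sw_path_content[OF assms(1)] \<open>p \<noteq> []\<close> by (simp add: last_conv_nth)
qed

text \<open>By \<open>P_path_eq\<close> below, such a path is unique and equals \<open>P(h, \<pi>)\<close>.\<close>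

definition insertion_path :: "cell list \<Rightarrow> (cell \<Rightarrow> enat) \<Rightarrow> cell list \<Rightarrow> bool" where
  "insertion_path h \<pi> p \<longleftrightarrow> sw_path lam p \<and> hd p = last h \<and> length p = length h \<and>
     compatible lam (set p) \<pi> \<and> rpp lam (add_cells \<pi> (set p))"

lemma insertion_pathD:
  assumes "insertion_path h \<pi> p"
  shows "sw_path lam p" "p \<noteq> []" "set p \<subseteq> diagram lam" "hd p = last h" "length p = length h"
    "compatible lam (set p) \<pi>" "rpp lam (add_cells \<pi> (set p))"
  using assms by (auto simp: insertion_path_def sw_path_def)

text \<open>Finiteness of \<pi> u makes the increment strict. This yields the strict inequalities
  between a path cell and a neighbour off the path.\<close>

lemma add_cells_less:
  assumes "rpp lam \<pi>" "u \<in> diagram lam" "u \<in> P" "v \<notin> P" "\<pi> v \<le> \<pi> u"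
  shows "add_cells \<pi> P v < add_cells \<pi> P u"
proof -
  have "\<pi> u < \<pi> u + 1" using rpp_finite[OF assms(1,2)] by (cases "\<pi> u") (auto simp: one_enat_def)
  with assms(5) have "\<pi> v < \<pi> u + 1" by (rule le_less_trans)
  then show ?thesis using assms(3,4) by (simp add: add_cells_def)
qed

lemma add_cells_ge: "\<pi> u \<le> add_cells \<pi> P u"
  by (cases "\<pi> u") (auto simp: add_cells_def one_enat_def)

section \<open>Uniqueness of the insertion path\<close>

text \<open>Compatibility and monotonicity of the enlarged filling together determine every step.
  The test agrees with \<open>P_step\<close>, since regions B and I consist of the cells with
  \<open>north_step\<close> at \<open>content u - 1\<close>.\<close>

lemma insertion_path_step:
  assumes \<pi>: "rpp lam \<pi>" and p: "insertion_path h \<pi> p" and k: "Suc k < length p"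
  shows "p ! Suc k = (if north_step lam (content (p ! k) - 1) \<and> \<pi> (p ! k) = \<pi> (south (p ! k))
    then south (p ! k) else west (p ! k))"
proof -
  define u where "u = p ! k"
  note P = insertion_pathD[OF p]
  have u: "u \<in> set p" "u \<in> diagram lam" using k P(3) by (auto simp: u_def)
  have nxt: "p ! Suc k \<in> set p" "p ! Suc k \<in> {south u, west u}"
    using k P(1) by (auto simp: sw_path_def u_def)
  show ?thesis
  proof (cases "north_step lam (content u - 1) \<and> \<pi> u = \<pi> (south u)")
    case True
    have "add_cells \<pi> (set p) u \<le> add_cells \<pi> (set p) (south u)"
      using P(7) u by (simp add: rpp_def)
    \<comment> \<open>Otherwise u would be raised above the equal value below it.\<close>
    then have "south u \<in> set p"
      using add_cells_less[OF \<pi> u(2,1), of "south u"] True by (metis leD order_refl)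
    then have "p ! Suc k = south u"
      using sw_path_content_inj[OF P(1) nxt(1), of "south u"] nxt(2) by auto
    then show ?thesis using True by (simp add: u_def)
  next
    case False
    have "p ! Suc k \<noteq> south u"
    proof
      assume "p ! Suc k = south u"
      then have s: "south u \<in> set p" using nxt by simp
      then have "\<pi> u = \<pi> (south u)" using P(6) u unfolding compatible_def by blast
      then have "\<not> north_step lam (content u - 1)" using False by simp
      \<comment> \<open>Compatibility at \<open>south u\<close> now puts its eastern neighbour on
        the path, on the diagonal of u.\<close>
      then have "south u \<in> region_I lam \<union> region_A lam"
        using s P(3) by (auto simp: region_iffs)
      then have "east (south u) \<in> set p" using P(6) s by (auto simp: compatible_def)
      from sw_path_content_inj[OF P(1) this u(1)] show False by (cases u) simp
    qed
    then show ?thesis using False nxt(2) by (auto simp: u_def)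
  qed
qed

lemma P_path_eq:
  assumes \<pi>: "rpp lam \<pi>" and p: "insertion_path h \<pi> p"
  shows "P_path lam h \<pi> = p"
proof -
  note P = insertion_pathD[OF p]
  have "(P_step lam \<pi> ^^ k) (last h) = p ! k" if "k < length p" for k
    using that
  proof (induction k)
    case 0
    then show ?case using P by (simp add: hd_conv_nth)
  next
    case (Suc k)
    then have "p ! k \<in> diagram lam" using P(3) by (auto intro: nth_mem)
    then have "P_step lam \<pi> (p ! k) = p ! Suc k"
      using insertion_path_step[OF \<pi> p Suc.prems] by (auto simp: P_step_def region_iffs)
    then show ?case using Suc by simp
  qed
  then show ?thesis
    unfolding P_path_def by (intro nth_equalityI) (use P in auto)
qed

text \<open>\<open>inserts\<close> asserts that some path works, while \<open>insert_hook\<close>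
  adds the explicit one; uniqueness identifies them.\<close>

lemma insert_hook_SomeD:
  assumes "rpp lam \<pi>" "insert_hook lam h \<pi> = Some \<pi>'"
  shows "\<exists>p. insertion_path h \<pi> p \<and> \<pi>' = add_cells \<pi> (set p)"
proof -
  obtain p where "insertion_path h \<pi> p"
    using assms(2) by (auto simp: insert_hook_def inserts_def insertion_path_def split: if_splits)
  then show ?thesis
    using assms P_path_eq[OF assms(1)] by (auto simp: insert_hook_def split: if_splits)
qed

lemma insertion_path_content_last:
  assumes "rim_hook lam h" "insertion_path h \<pi> p"
  shows "content (last p) = content (hd h)"
proof -
  note P = insertion_pathD[OF assms(2)]
  have ne: "ne_path lam h" "h \<noteq> []" using assms(1) by (auto simp: rim_hook_def ne_path_def)
  have "content (last h) = content (hd h) + int (length h) - 1"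
    using ne_path_content[OF ne(1), of "length h - 1"] ne
    by (simp add: last_conv_nth Suc_le_eq of_nat_diff)
  then show ?thesis using content_last_sw_path[OF P(1)] P by simp
qed

text \<open>The head of h is the bottom of its column, on the diagonal of \<open>last p\<close>.
  Hence \<open>last p\<close> lies in region O or A, as candidates must.\<close>

lemma insertion_path_last_no_north_step:
  assumes "rim_hook lam h" "insertion_path h \<pi> p"
  shows "\<not> north_step lam (content (last p) - 1)"
proof -
  have "hd h \<in> diagram lam" "south (hd h) \<notin> diagram lam"
    using assms(1) by (auto simp: rim_hook_def ne_path_def)
  then show ?thesis
    using no_north_step_below_column insertion_path_content_last[OF assms]
    by (cases "hd h") auto
qed

lemma insertion_path_east:
  assumes "insertion_path h \<pi> p" "u \<in> set p" "\<not> north_step lam (content u)"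
  shows "east u \<in> set p"
  using insertion_pathD[OF assms(1)] assms(2,3)
  by (fastforce simp: compatible_def region_iffs)

section \<open>Candidates after an insertion\<close>

text \<open>The western neighbour lies on a diagonal that the path does not reach. In region A the
  path contains the eastern neighbour of its head, which shares a diagonal with the northern one, so
  neither west nor north is raised.\<close>

lemma last_insertion_path_cand:
  assumes \<pi>: "rpp lam \<pi>" and h: "rim_hook lam h" and p: "insertion_path h \<pi> p"
  shows "last p \<in> cand lam (add_cells \<pi> (set p))"
proof -
  note P = insertion_pathD[OF p]
  let ?a = "last p"
  have a: "?a \<in> set p" "?a \<in> diagram lam" using P by auto
  have "west ?a \<notin> set p" using sw_path_content_last[OF P(1), of "west ?a"] by auto
  then have w: "add_cells \<pi> (set p) (west ?a) < add_cells \<pi> (set p) ?a"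
    by (intro add_cells_less \<pi> a rpp_west_le) auto
  have n: "\<not> north_step lam (content ?a - 1)" by (rule insertion_path_last_no_north_step[OF h p])
  show ?thesis
  proof (cases "north_step lam (content ?a)")
    case True
    then show ?thesis using w n a by (auto simp: cand_def region_iffs)
  next
    case False
    have "east ?a \<in> set p" by (rule insertion_path_east[OF p a(1) False])
    then have "north ?a \<notin> set p"
      using sw_path_content_inj[OF P(1), of "east ?a" "north ?a"] by (cases ?a) auto
    then have "add_cells \<pi> (set p) (north ?a) < add_cells \<pi> (set p) ?a"
      by (intro add_cells_less \<pi> a rpp_north_le) auto
    then show ?thesis using w n False a by (auto simp: cand_def region_iffs)
  qed
qed

lemma content_le_iff:
  "content_le u v \<longleftrightarrow> content u > content v \<or> (content u = content v \<and> fst u \<ge> fst v)"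
  by (cases u; cases v; simp)

text \<open>An earlier candidate off the path would be an old candidate. One on the path is left
  westwards, so its inequality to the west held before, and climbing from it gives an old candidate
  of larger content than the head.\<close>

lemma cand_add_insertion_path:
  assumes \<pi>: "rpp lam \<pi>" and p: "insertion_path h \<pi> p"
    and min: "\<forall>u\<in>cand lam \<pi>. content_le (last p) u"
    and u: "u \<in> cand lam (add_cells \<pi> (set p))"
  shows "content_le (last p) u"
proof (rule ccontr)
  assume not_le: "\<not> content_le (last p) u"
  note P = insertion_pathD[OF p]
  have ud: "u \<in> diagram lam" using u by (rule cand_in_diagram)
  have n: "\<not> north_step lam (content u - 1)"
    using u ud by (auto simp: cand_def region_iffs)
  have w: "add_cells \<pi> (set p) (west u) < add_cells \<pi> (set p) u"
    using u by (auto simp: cand_def)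
  have up: "u \<in> set p"
  proof (rule ccontr)
    assume "u \<notin> set p"
    then have "add_cells \<pi> (set p) u = \<pi> u" by (simp add: add_cells_def)
    then have "u \<in> cand lam \<pi>"
      using u add_cells_ge[of \<pi> "west u" "set p"] add_cells_ge[of \<pi> "north u" "set p"]
      by (auto simp: cand_def intro: le_less_trans)
    then show False using min not_le by blast
  qed
  have gt: "content (last p) < content u"
    using sw_path_content_last[OF P(1) up] not_le sw_path_content_inj[OF P(1) up last_in_set[OF P(2)]]
    by (metis content_le_iff order_le_less order_refl)
  obtain k where k: "k < length p" "u = p ! k" using up by (auto simp: in_set_conv_nth)
  have "k \<noteq> length p - 1" using gt k P(2) by (auto simp: last_conv_nth)
  then have k': "Suc k < length p" using k by auto
  then have "west u = p ! Suc k" using insertion_path_step[OF \<pi> p k'] n k by simp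
  then have "west u \<in> set p" using k' by simp
  \<comment> \<open>Both cells were raised, so the inequality predates the insertion.\<close>
  then have "\<pi> (west u) < \<pi> u"
    using w up by (cases "\<pi> (west u)"; cases "\<pi> u") (auto simp: add_cells_def one_enat_def)
  then obtain v where "v \<in> cand lam \<pi>" "content u \<le> content v"
    using ex_cand_content_ge[OF \<pi> ud n] by blast
  then show False using min gt by (auto simp: content_le_iff)
qed

section \<open>Comparing consecutive insertions\<close>

text \<open>The paths are compared diagonal by diagonal; p starts on the rim, hence weakly below q.
  Where they meet and q turns south, q raises both cells of that step, so the equality that sent q
  south persists and sends p south too.\<close>

lemma insertion_paths_noncrossing:
  assumes \<pi>: "rpp lam \<pi>" and g: "insertion_path g \<pi> q"
    and h: "rim_hook lam h" and p: "insertion_path h (add_cells \<pi> (set q)) p"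
    and tails: "content (last h) \<le> content (last g)"
    and heads: "content (last p) = content (last q)"
  shows "fst (last q) \<le> fst (last p)"
proof -
  note G = insertion_pathD[OF g] and P = insertion_pathD[OF p]
  \<comment> \<open>q takes d steps to reach the diagonal where p starts.\<close>
  define d where "d = nat (content (last g) - content (last h))"
  have len: "length q = length p + d"
    using content_last_sw_path[OF P(1)] content_last_sw_path[OF G(1)] P(4) G(4) heads tails
    unfolding d_def by simp
  have same_content: "content (p ! k) = content (q ! (k + d))" if "k < length p" for k
    using sw_path_content[OF P(1), of k] sw_path_content[OF G(1), of "k + d"] that len P(4) G(4) tails
    by (simp add: d_def)
  have "fst (q ! (k + d)) \<le> fst (p ! k)" if "k < length p" for k
    using that
  proof (induction k)
    case 0
    then have "q ! d \<in> diagram lam" using len G(3) by auto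
    moreover have "east (south (p ! 0)) \<notin> diagram lam" "p ! 0 \<in> diagram lam"
      using h P by (auto simp: rim_hook_def ne_path_def hd_conv_nth)
    moreover have "content (q ! d) = content (p ! 0)" using same_content[of 0] 0 by simp
    \<comment> \<open>If q were further down this diagonal, \<open>east (south (p ! 0))\<close>
      would be in the diagram.\<close>
    ultimately show ?case
      using diagram_down[OF lam, of "fst (q ! d)" "snd (q ! d)" "fst (p ! 0) + 1" "snd (p ! 0) + 1"]
      by (cases "q ! d"; cases "p ! 0") (force simp: diagram_iff)
  next
    case (Suc k)
    define u where "u = p ! k"
    define v where "v = q ! (k + d)"
    have kq: "Suc (k + d) < length q" using len Suc.prems by simp
    have nxt_p: "p ! Suc k = (if north_step lam (content u - 1) \<and>
        add_cells \<pi> (set q) u = add_cells \<pi> (set q) (south u) then south u else west u)"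
      using insertion_path_step[OF G(7) p Suc.prems] by (simp add: u_def)
    have nxt_q: "q ! Suc (k + d) = (if north_step lam (content v - 1) \<and> \<pi> v = \<pi> (south v)
        then south v else west v)"
      using insertion_path_step[OF \<pi> g kq] by (simp add: v_def)
    have fsts: "fst (south w) = fst w + 1" "fst (west w) = fst w" for w by (cases w; simp)+
    have le: "fst v \<le> fst u" using Suc by (simp add: u_def v_def)
    have "fst (q ! Suc (k + d)) \<le> fst (p ! Suc k)"
    proof (cases "u = v \<and> q ! Suc (k + d) = south v")
      case True
      have "v \<in> set q" "south v \<in> set q"
        using True kq nth_mem[OF kq] by (auto simp: v_def)
      moreover have "north_step lam (content v - 1) \<and> \<pi> v = \<pi> (south v)"
        using True nxt_q by (cases v) (auto split: if_splits)
      ultimately have "p ! Suc k = south u" using True nxt_p by (simp add: add_cells_def)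
      then show ?thesis using True by simp
    next
      case False
      show ?thesis
      proof (cases "u = v")
        case True
        then show ?thesis using False nxt_p nxt_q by (auto simp: fsts split: if_splits)
      next
        case False
        have "content u = content v" using same_content[of k] Suc.prems by (simp add: u_def v_def)
        then have "fst v < fst u" using False le cell_eqI[of u v] by force
        then show ?thesis using nxt_p nxt_q by (auto simp: fsts split: if_splits)
      qed
    qed
    then show ?case by simp
  qed
  moreover have "length p - 1 + d = length q - 1" using len P(2) by (cases p) auto
  ultimately show ?thesis
    using P(2) G(2) by (metis last_conv_nth diff_less length_greater_0_conv zero_less_one)
qed

text \<open>For equal columns the heads agree, and the lower row ends on a diagonal no larger.
  Otherwise the head of g lies further right, in a column that is no longer.\<close>

lemma hook_le_contents:
  assumes "hook_le lam g h"
  shows "content (hd h) < content (hd g) \<or>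
    (content (hd h) = content (hd g) \<and> content (last g) \<le> content (last h))"
proof -
  obtain i j k l where g: "is_hook_at lam (i, j) g" and h: "is_hook_at lam (k, l) h"
    and le: "revlex_le (i, j) (k, l)"
    using assms by (auto simp: hook_le_def)
  show ?thesis
  proof (cases "j = l")
    case True
    then have "part lam i \<le> part lam k"
      using part_antimono[OF lam, of k i] le h by (auto simp: diagram_iff)
    then show ?thesis using True g h le by auto
  next
    case False
    then have "l < j" using le by simp
    have gd: "(conj_part lam j, j) \<in> diagram lam"
      using g unfolding is_hook_at.simps rim_hook_def ne_path_def by (metis hd_in_set subsetD)
    have hd: "(conj_part lam l, l) \<in> diagram lam" "(conj_part lam l + 1, l) \<notin> diagram lam"
      using h unfolding is_hook_at.simps rim_hook_def ne_path_def
      by (metis hd_in_set subsetD, metis south.simps)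
    have "conj_part lam j \<le> conj_part lam l"
    proof (rule ccontr)
      assume "\<not> ?thesis"
      then have "(conj_part lam l + 1, l) \<in> diagram lam"
        using gd hd \<open>l < j\<close> by (intro diagram_down[OF lam gd]) (auto simp: diagram_iff)
      with hd show False by simp
    qed
    then show ?thesis using \<open>l < j\<close> g h by simp
  qed
qed

section \<open>Lexicographic factorisations\<close>

text \<open>The induction carries the bound on candidates along, since each insertion needs it for
  the previous filling. That \<open>last p\<close> is itself a candidate is left to
  \<open>last_insertion_path_cand\<close>.\<close>

lemma lex_factorisation_last_step:
  assumes "lex_factorisation lam \<pi> (h # hs)"
  shows "\<exists>\<pi>' p. insert_hooks lam hs = Some \<pi>' \<and> rpp lam \<pi>' \<and> insertion_path h \<pi>' p \<and>
    \<pi> = add_cells \<pi>' (set p) \<and> (\<forall>u\<in>cand lam \<pi>. content_le (last p) u)"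
  using assms
proof (induction hs arbitrary: h \<pi>)
  case Nil
  then have "insert_hook lam h (zero_rpp lam) = Some \<pi>" by (simp add: lex_factorisation_def)
  from insert_hook_SomeD[OF rpp_zero this] obtain p
    where p: "insertion_path h (zero_rpp lam) p" "\<pi> = add_cells (zero_rpp lam) (set p)" by auto
  \<comment> \<open>The zero filling has no candidates, so the assumption on old candidates is
    vacuous.\<close>
  then have "\<forall>u\<in>cand lam \<pi>. content_le (last p) u"
    using cand_add_insertion_path[OF rpp_zero p(1)] by (simp add: cand_zero)
  then show ?case using p rpp_zero by auto
next
  case (Cons g hs)
  obtain \<pi>' where \<pi>': "insert_hooks lam (g # hs) = Some \<pi>'" "insert_hook lam h \<pi>' = Some \<pi>"
    using Cons.prems unfolding lex_factorisation_def insert_hooks.simps(2)[of lam h]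
    by (cases "insert_hooks lam (g # hs)") (auto simp del: insert_hooks.simps)
  have hooks: "rim_hook lam h" "rim_hook lam g" "hook_le lam h g"
    using Cons.prems by (auto simp: lex_factorisation_def)
  have "lex_factorisation lam \<pi>' (g # hs)"
    using Cons.prems \<pi>'(1) by (auto simp: lex_factorisation_def)
  from Cons.IH[OF this] obtain \<rho> q where q: "rpp lam \<rho>" "insertion_path g \<rho> q"
    "\<pi>' = add_cells \<rho> (set q)" "\<forall>u\<in>cand lam \<pi>'. content_le (last q) u" by blast
  have r': "rpp lam \<pi>'" using insertion_pathD(7)[OF q(2)] q(3) by simp
  obtain p where p: "insertion_path h \<pi>' p" "\<pi> = add_cells \<pi>' (set p)"
    using insert_hook_SomeD[OF r' \<pi>'(2)] by auto
  \<comment> \<open>Either the new head has larger content, or the contents agree and the order of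
    the tails allows the comparison of rows.\<close>
  have "content_le (last p) (last q)"
    using hook_le_contents[OF hooks(3)] insertion_paths_noncrossing[OF q(1,2) hooks(1), of p] p(1) q(3)
      insertion_path_content_last[OF hooks(1) p(1)] insertion_path_content_last[OF hooks(2) q(2)]
    by (auto simp: content_le_iff)
  then have "\<forall>u\<in>cand lam \<pi>'. content_le (last p) u"
    using q(4) by (force simp: content_le_iff)
  then have "\<forall>u\<in>cand lam \<pi>. content_le (last p) u"
    using cand_add_insertion_path[OF r' p(1)] p(2) by simp
  then show ?case using \<pi>' r' p by blast
qed

section \<open>Extraction reverses insertion\<close>

text \<open>A reversed south step joins equal values, both raised, and starts in region O or B. For
  a reversed west step, the cell above its start shares a diagonal with its end, so it is off the
  path and strictly smaller than the start.\<close>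

lemma Q_path_rev_insertion_path:
  assumes \<pi>: "rpp lam \<pi>" and h: "rim_hook lam h" and p: "insertion_path h \<pi> p"
  shows "Q_path lam (add_cells \<pi> (set p)) (last p) (rev p)"
proof -
  note P = insertion_pathD[OF p]
  let ?\<pi> = "add_cells \<pi> (set p)"
  have less: "?\<pi> (north u) < ?\<pi> u" if "u \<in> set p" "north u \<notin> set p" for u
    using that P(3) by (intro add_cells_less \<pi> rpp_north_le) auto
  have step: "(Q_moves_north lam ?\<pi> (rev p ! k) \<and> rev p ! Suc k = north (rev p ! k)) \<or>
      (Q_moves_east lam ?\<pi> (rev p ! k) \<and> rev p ! Suc k = east (rev p ! k))"
    if k: "Suc k < length p" for k
  proof -
    \<comment> \<open>Step k of the reversed path undoes the step of p from x to u.\<close>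
    define m where "m = length p - Suc (Suc k)"
    define u where "u = p ! Suc m"
    define x where "x = p ! m"
    have m: "Suc m < length p" "rev p ! k = u" "rev p ! Suc k = x"
      using k by (auto simp: m_def u_def x_def rev_nth Suc_diff_Suc)
    have mem: "u \<in> set p" "x \<in> set p" "u \<in> diagram lam" "x \<in> diagram lam"
      using m(1) P(3) by (auto simp: u_def x_def)
    have nxt: "u = (if north_step lam (content x - 1) \<and> \<pi> x = \<pi> (south x) then south x else west x)"
      using insertion_path_step[OF \<pi> p m(1)] by (simp add: u_def x_def)
    show ?thesis
    proof (cases "north_step lam (content x - 1) \<and> \<pi> x = \<pi> (south x)")
      case True
      then have u: "u = south x" "x = north u" using nxt by (cases x; simp)+
      then have "?\<pi> u = ?\<pi> (north u)" using True mem by (simp add: add_cells_def)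
      moreover have "u \<in> region_O lam \<union> region_B lam"
        using True mem(3) u(1) by (auto simp: region_iffs)
      ultimately show ?thesis using u(2) m(2,3) by (simp add: Q_moves_north_def)
    next
      case False
      then have x: "x = east u" using nxt by (cases x; auto)
      then have "north u \<notin> set p"
        using sw_path_content_inj[OF P(1) mem(2), of "north u"] by (cases u) auto
      then have "Q_moves_east lam ?\<pi> u"
        using less mem x by (auto simp: Q_moves_east_def)
      then show ?thesis using x m(2,3) by simp
    qed
  qed
  have "ne_path lam (rev p)"
    using P(2,3) step unfolding ne_path_def by auto
  moreover have "Q_stops lam ?\<pi> (last (rev p))"
  proof -
    have "content u \<le> content (hd p)" if "u \<in> set p" for u
      using that sw_path_content[OF P(1)] by (auto simp: in_set_conv_nth)
    from this[of "north (hd p)"] have "north (hd p) \<notin> set p" by auto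
    then have "?\<pi> (north (hd p)) < ?\<pi> (hd p)" using less P(2) by simp
    moreover have "east (hd p) \<notin> diagram lam" using h P(4) by (simp add: rim_hook_def)
    ultimately show ?thesis using P(2) by (simp add: Q_stops_def last_rev)
  qed
  ultimately show ?thesis using P(2) step by (simp add: Q_path_def hd_rev)
qed

end

text \<open>Truncation is harmless after adding 1, and infinite values are fixed by both
  operations.\<close>

lemma sub_cells_add_cells: "sub_cells (add_cells \<pi> P) P = \<pi>"
proof
  fix u show "sub_cells (add_cells \<pi> P) P u = \<pi> u"
    by (cases "\<pi> u") (auto simp: sub_cells_def add_cells_def one_enat_def)
qed

theorem mainTheorem16:
  fixes lam :: "nat list" and \<pi> :: "cell \<Rightarrow> enat"
    and h :: "cell list" and hs :: "cell list list"
  assumes "is_partition lam"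
    and "rpp lam \<pi>"
    and "lex_factorisation lam \<pi> (h # hs)"
  shows "\<exists>v q. is_min_cand lam \<pi> v \<and> Q_path lam \<pi> v q \<and>
           (\<forall>u\<in>set q. 1 \<le> \<pi> u) \<and>
           insert_hooks lam hs = Some (sub_cells \<pi> (set q))"
proof -
  note lam = assms(1)
  have h: "rim_hook lam h" using assms(3) by (simp add: lex_factorisation_def)
  obtain \<pi>' p where p: "insert_hooks lam hs = Some \<pi>'" "rpp lam \<pi>'" "insertion_path lam h \<pi>' p"
      "\<pi> = add_cells \<pi>' (set p)" "\<forall>u\<in>cand lam \<pi>. content_le (last p) u"
    using lex_factorisation_last_step[OF lam assms(3)] by blast
  have "is_min_cand lam \<pi> (last p)"
    using last_insertion_path_cand[OF lam p(2) h p(3)] p(4,5) by (simp add: is_min_cand_def)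
  moreover have "Q_path lam \<pi> (last p) (rev p)"
    using Q_path_rev_insertion_path[OF lam p(2) h p(3)] p(4) by simp
  \<comment> \<open>Positivity on the path makes the truncated difference the genuine one.\<close>
  moreover have "\<forall>u\<in>set (rev p). 1 \<le> \<pi> u"
    using p(4) by (simp add: add_cells_def)
  moreover have "insert_hooks lam hs = Some (sub_cells \<pi> (set (rev p)))"
    using p(1,4) by (simp add: sub_cells_add_cells)
  ultimately show ?thesis by blast
qed

end
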